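(* Let $\tau\in\mathbb{C}$ with $\mathrm{Im}(\tau)>0$, $q=e^{2\pi i\tau}$, $\alpha,u,v\in\mathbb{C}$, $x=e^{2\pi iu}$, $y=e^{2\pi iv}$, $a=q^\alpha=e^{2\pi i\alpha\tau}$, with $x,\,y,\,x/a,\,y/a\notin\{q^n\}_{n\in\mathbb{Z}}$. Then $$\mu(x,y;a)=-iq^{-\frac18}\frac{(x/y)^{\frac{\alpha}{2}}}{\theta_q(-x/a)}\frac{(aq/y)_\infty}{(q/y)_\infty}\;{}_1\psi_2\left(\begin{matrix} y/a \\ 0,y \end{matrix};q,x\right),$$ and, when $|a|<1$ (so that the bilateral series below converge), $$\mu(x,y;a)=-iq^{-\frac18}\left(\frac xy\right)^{\frac\alpha2}\frac{(a,q,aq/x,aq/y)_\infty}{\theta_q(-y)\theta_q(-x/a)}\;{}_2\psi_2\left(\begin{matrix} x/a,y/a \\ 0,0 \end{matrix};q,a\right)$$ $$=-iq^{-\frac18}\left(\frac xy\right)^{\frac\alpha2}\frac{(a,q,x,y)_\infty}{\theta_q(-y)\theta_q(-x/a)}\;{}_0\psi_2\left(\begin{matrix} - \\ x,y \end{matrix};q,\frac{xy}{a}\right).$$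
   Context: Powers: $q^s:=e^{2\pi is\tau}$ and $(x/y)^{\alpha/2}:=e^{\pi i\alpha(u-v)}$. $(x)_\infty=(x;q)_\infty=\prod_{j\ge0}(1-xq^j)$, $(x)_n=(x)_\infty/(q^nx)_\infty$ for $n\in\mathbb{Z}$ (for $x=0$: $(0)_n=1$), $(x_1,\dots,x_m)_n=(x_1)_n\cdots(x_m)_n$ for $n\in\mathbb{Z}\cup\{\infty\}$. $\theta_q(x)=(q,-x,-q/x)_\infty=\sum_{n\in\mathbb{Z}}x^nq^{n(n-1)/2}$. Bilateral series: ${}_r\psi_s\left(\begin{matrix} a_1,\dots,a_r \\ b_1,\dots,b_s \end{matrix};q,x\right)=\sum_{n\in\mathbb{Z}}\frac{(a_1,\dots,a_r)_n}{(b_1,\dots,b_s)_n}\big((-1)^nq^{n(n-1)/2}\big)^{s-r}x^n$. Generalized $\mu$-function in multiplicative notation (for $x/a,y\notin\{q^n\}_{n\in\mathbb{Z}}$): $$\mu(x,y;a)=-iq^{-\frac18}\frac{(x/y)^{\frac\alpha2}}{\theta_q(-y)}\frac{(x)_\infty}{(x/a)_\infty}\;{}_1\psi_2\left(\begin{matrix} x/a \\ 0,x \end{matrix};q,y\right).$$ *)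

theory Defs
  imports "HOL-Analysis.Analysis"
begin

text \<open>Powers of \<open>q\<close> are taken with respect to a fixed \<open>\<tau>\<close>: \<open>q\<^sup>s = e\<^sup>2\<^sup>\<pi>\<^sup>i\<^sup>s\<^sup>\<tau>\<close>.\<close>

definition qpow :: "complex \<Rightarrow> complex \<Rightarrow> complex" where
  "qpow \<tau> s = exp (2 * of_real pi * \<i> * s * \<tau>)"

definition cis2pi :: "complex \<Rightarrow> complex" where
  "cis2pi u = exp (2 * of_real pi * \<i> * u)"

definition qpoch_inf :: "complex \<Rightarrow> complex \<Rightarrow> complex" where
  "qpoch_inf q x = (\<Prod>j. 1 - x * q ^ j)"

text \<open>Only meaningful where the denominator does not vanish, in particular for
  \<open>x\<close> that is not an integer power of \<open>q\<close>.\<close>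

definition qpoch :: "complex \<Rightarrow> complex \<Rightarrow> int \<Rightarrow> complex" where
  "qpoch q x n = qpoch_inf q x / qpoch_inf q (q powi n * x)"

definition qpochs_inf :: "complex \<Rightarrow> complex list \<Rightarrow> complex" where
  "qpochs_inf q xs = (\<Prod>x\<leftarrow>xs. qpoch_inf q x)"

definition qpochs :: "complex \<Rightarrow> complex list \<Rightarrow> int \<Rightarrow> complex" where
  "qpochs q xs n = (\<Prod>x\<leftarrow>xs. qpoch q x n)"

definition qtheta :: "complex \<Rightarrow> complex \<Rightarrow> complex" where
  "qtheta q x = qpochs_inf q [q, - x, - q / x]"

text \<open>The bilateral series with upper parameters \<open>as\<close> and lower parameters \<open>bs\<close>.
  The exponent \<open>s - r\<close> is an integer and may be negative; the division by 2 is exact.\<close>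

definition qpsi_term ::
    "complex list \<Rightarrow> complex list \<Rightarrow> complex \<Rightarrow> complex \<Rightarrow> int \<Rightarrow> complex" where
  "qpsi_term as bs q x n =
     qpochs q as n / qpochs q bs n
     * ((- 1) powi n * q powi (n * (n - 1) div 2)) powi (int (length bs) - int (length as))
     * x powi n"

definition qpsi_converges ::
    "complex list \<Rightarrow> complex list \<Rightarrow> complex \<Rightarrow> complex \<Rightarrow> bool" where
  "qpsi_converges as bs q x \<longleftrightarrow> qpsi_term as bs q x summable_on UNIV"

definition qpsi :: "complex list \<Rightarrow> complex list \<Rightarrow> complex \<Rightarrow> complex \<Rightarrow> complex" where
  "qpsi as bs q x = (\<Sum>\<^sub>\<infinity>n\<in>UNIV. qpsi_term as bs q x n)"

text \<open>The power \<open>(x/y)\<^sup>\<alpha>\<^sup>/\<^sup>2\<close> is \<open>e\<^sup>\<pi>\<^sup>i\<^sup>\<alpha>\<^sup>(\<^sup>u\<^sup>-\<^sup>v\<^sup>)\<close>; it depends on the choice of \<open>u\<close>, \<open>v\<close> and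
  not only on \<open>x\<close>, \<open>y\<close>.\<close>

definition ratio_pow :: "complex \<Rightarrow> complex \<Rightarrow> complex \<Rightarrow> complex" where
  "ratio_pow \<alpha> u v = exp (of_real pi * \<i> * \<alpha> * (u - v))"

text \<open>The generalized \<open>\<mu>\<close>-function \<open>\<mu>(x,y;a)\<close> in terms of the additive variables \<open>u\<close>, \<open>v\<close>, \<open>\<alpha>\<close>
  with \<open>x = e\<^sup>2\<^sup>\<pi>\<^sup>i\<^sup>u\<close>, \<open>y = e\<^sup>2\<^sup>\<pi>\<^sup>i\<^sup>v\<close>, \<open>a = q\<^sup>\<alpha>\<close>. Its domain is \<open>Im \<tau> > 0\<close> with neither \<open>x/a\<close> nor \<open>y\<close>
  an integer power of \<open>q\<close>.\<close>

definition gmu :: "complex \<Rightarrow> complex \<Rightarrow> complex \<Rightarrow> complex \<Rightarrow> complex" where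
  "gmu \<tau> u v \<alpha> =
     (let q = cis2pi \<tau>; x = cis2pi u; y = cis2pi v; a = qpow \<tau> \<alpha> in
        - \<i> * qpow \<tau> (- 1 / 8) * (ratio_pow \<alpha> u v / qtheta q (- y))
        * (qpoch_inf q x / qpoch_inf q (x / a))
        * qpsi [x / a] [0, x] q y)"

end

theory Submission
  imports Defs
begin

text \<open>
  Write \<open>P z\<close> for \<open>(z; q)\<^sub>\<infinity>\<close>. All four series are multiples of one function, symmetric in
  \<open>x\<close> and \<open>y\<close>. The theta function shift
  \[ P(z) P(q/z) = (-z)^n q^{n(n-1)/2} P(z q^n) P(q^{1-n}/z) \]
  at \<open>z = x/a\<close> turns the quotients \<open>(x/a)\<^sub>n / (x)\<^sub>n\<close> of the series \<open>1\<psi>2\<close> into products without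
  denominators, and the series becomes, up to the factor \<open>P x * P (a q / x)\<close>,
  \[ H(x, y) = \sum_{n \in Z} (xy/a)^n q^{n(n-1)} P(x q^n) P(a q^{1-n}/x). \]

  Symmetry of \<open>H\<close>. Expand both products by Euler's formula
  \<open>P z = \<Sum>k. (-z)^k q^(k choose 2) / (q; q)\<^sub>k\<close>, with indices \<open>k\<close> and \<open>l\<close>, and replace \<open>n\<close> by
  \<open>n + l\<close>. The exponents rearrange so that \<open>x\<close> occurs to the power \<open>n + k\<close> and \<open>y\<close> to the power
  \<open>n + l\<close>, and everything else depends symmetrically on \<open>k\<close> and \<open>l\<close>:
  \[ H(x, y) = \sum_n (xy/a)^n q^{n(n-1)} \Phi(x q^n, y q^n), \quad
     \Phi(X, Y) = \sum_{k,l} \frac{(-X)^k (-Y)^l q^{(k+l)(k+l-1)/2}}{(q;q)_k (q;q)_l}. \]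
  The exponent of \<open>q\<close> has a positive definite quadratic part in \<open>(n, k + l)\<close>, so the triple series
  converges absolutely for all nonzero \<open>x\<close>, \<open>y\<close>, \<open>a\<close> and the rearrangement is legitimate. This is
  \<open>H_eq_Phi\<close> and \<open>H_commute\<close>, and gives the first formula.

  The case \<open>|a| < 1\<close>. Let \<open>K\<close> be the series \<open>H\<close> with \<open>P (y q^n)\<close> in place of \<open>P (a q^(1-n) / x)\<close>;
  it is \<open>P x * P y\<close> times the series \<open>0\<psi>2\<close>. Expanding the factor \<open>P a\<close> of \<open>P a * K\<close> by Euler's
  formula and shifting \<open>n\<close> in the same manner gives the above double series with
  \[ \sum_m \frac{(-XY)^m q^{3m(m-1)/2}}{(q;q)_m} P(X q^m) P(Y q^m) \]
  in place of \<open>\<Phi>(X, Y)\<close>. The two agree (\<open>Phi_eq_psi\<close>) by a finite identity of Durfee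
  rectangle type (\<open>sum_rfac_P\<close>). Hence \<open>H = P a * K\<close> (\<open>H_eq_K\<close>), which is the formula with
  \<open>0\<psi>2\<close>. Finally the reversal \<open>n \<mapsto> -n\<close> shows that \<open>H\<close> is invariant under
  \<open>(x, y) \<mapsto> (a q / x, a q / y)\<close> (\<open>H_reflect\<close>) and turns the series \<open>2\<psi>2\<close> into the series \<open>K\<close> at
  the reflected point, which is the remaining formula.
\<close>

section \<open>Absolutely convergent sums with Gaussian terms\<close>

lemma of_nat_choose_two:
  "of_nat (k choose 2) = (of_nat k * (of_nat k - 1) / 2 :: 'a :: field_char_0)"
proof (induction k)
  case (Suc k)
  have "of_nat (Suc k choose 2) = (of_nat k + of_nat (k choose 2) :: 'a)"
    by (simp add: numeral_2_eq_2)
  then show ?case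
    unfolding Suc.IH by (simp add: field_simps)
qed auto

lemma summable_on_int_exp_neg_abs:
  "(\<lambda>n::int. exp (- \<bar>real_of_int n\<bar>)) summable_on UNIV"
proof -
  have geom: "summable (\<lambda>n. exp (-1 :: real) ^ n)"
    by (intro summable_geometric) simp
  have nat: "(\<lambda>n::nat. exp (- real n)) summable_on UNIV"
    using geom by (intro summable_nonneg_imp_summable_on) (simp_all flip: exp_of_nat_mult)
  have pos: "(\<lambda>n::int. exp (- \<bar>real_of_int n\<bar>)) summable_on range int"
    using nat by (subst summable_on_reindex) (auto simp: o_def)
  have neg: "(\<lambda>n::int. exp (- \<bar>real_of_int n\<bar>)) summable_on range (\<lambda>k. - int k)"
    using nat by (subst summable_on_reindex) (auto simp: o_def inj_on_def)
  have "(UNIV :: int set) = range int \<union> range (\<lambda>k. - int k)"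
    by (auto, metis int_cases2 rangeI)
  then show ?thesis
    using summable_on_union[OF pos neg] by simp
qed

text \<open>
  Completing the square bounds a Gaussian with an arbitrary linear term by a constant times
  \<open>exp (- \<bar>n\<bar>)\<close>.
\<close>

lemma summable_on_int_gauss:
  fixes A d :: real
  assumes "d > 0"
  shows "(\<lambda>n::int. exp (A * of_int n - d * (of_int n)\<^sup>2)) summable_on UNIV"
proof (rule summable_on_comparison_test)
  let ?C = "(\<bar>A\<bar> + 1)\<^sup>2 / (4 * d)"
  show "(\<lambda>n::int. exp ?C * exp (- \<bar>real_of_int n\<bar>)) summable_on UNIV"
    by (intro summable_on_cmult_right summable_on_int_exp_neg_abs)
  fix n :: int
  define t where "t = \<bar>real_of_int n\<bar>"
  have t2: "(real_of_int n)\<^sup>2 = t\<^sup>2"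
    by (simp add: t_def)
  have "A * of_int n \<le> \<bar>A\<bar> * t"
    unfolding t_def by (metis abs_ge_self abs_mult)
  moreover have "(\<bar>A\<bar> + 1) * t - d * t\<^sup>2 \<le> ?C"
  proof -
    have "0 \<le> (2 * d * t - (\<bar>A\<bar> + 1))\<^sup>2"
      by simp
    then have "4 * d * ((\<bar>A\<bar> + 1) * t - d * t\<^sup>2) \<le> (\<bar>A\<bar> + 1)\<^sup>2"
      by (simp add: power2_eq_square algebra_simps)
    then show ?thesis
      using assms by (simp add: field_simps)
  qed
  ultimately have "A * of_int n - d * (of_int n)\<^sup>2 \<le> ?C + (- t)"
    unfolding t2 by (simp add: algebra_simps)
  then show "exp (A * of_int n - d * (of_int n)\<^sup>2) \<le> exp ?C * exp (- \<bar>real_of_int n\<bar>)"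
    by (simp add: t_def flip: exp_add)
qed auto

lemma summable_on_nat_gauss:
  fixes A d :: real
  assumes "d > 0"
  shows "(\<lambda>n::nat. exp (A * of_nat n - d * (of_nat n)\<^sup>2)) summable_on UNIV"
proof -
  have "(\<lambda>n::int. exp (A * of_int n - d * (of_int n)\<^sup>2)) summable_on range int"
    by (rule summable_on_subset[OF summable_on_int_gauss[OF assms]]) simp
  then show ?thesis
    by (subst (asm) summable_on_reindex) (auto simp: o_def)
qed

lemma summable_on_Times_nonneg:
  fixes f :: "'a \<Rightarrow> real" and g :: "'b \<Rightarrow> real"
  assumes "f summable_on A" "g summable_on B" "\<And>x. f x \<ge> 0" "\<And>y. g y \<ge> 0"
  shows "(\<lambda>(x, y). f x * g y) summable_on A \<times> B"
proof (rule summable_on_SigmaI)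
  show "((\<lambda>y. case (x, y) of (x, y) \<Rightarrow> f x * g y) has_sum (f x * infsum g B)) B" for x
    using has_sum_cmult_right[OF has_sum_infsum[OF assms(2)]] by simp
  show "(\<lambda>x. f x * infsum g B) summable_on A"
    by (intro summable_on_cmult_left assms)
qed (use assms in auto)

lemma summable_on_norm_bound:
  fixes f :: "'a \<Rightarrow> complex"
  assumes "g summable_on A" "\<And>x. x \<in> A \<Longrightarrow> norm (f x) \<le> g x"
  shows "f summable_on A"
  by (rule abs_summable_summable, rule Infinite_Sum.abs_summable_on_comparison_test'[OF assms])

lemma infsum_Times_product:
  fixes f :: "'a \<Rightarrow> complex" and g :: "'b \<Rightarrow> complex"
  assumes f: "(\<lambda>x. norm (f x)) summable_on A" and g: "(\<lambda>y. norm (g y)) summable_on B"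
  shows "(\<lambda>(x, y). f x * g y) summable_on A \<times> B"
    and "infsum (\<lambda>(x, y). f x * g y) (A \<times> B) = infsum f A * infsum g B"
proof -
  have "(\<lambda>(x, y). norm (f x) * norm (g y)) summable_on A \<times> B"
    by (intro summable_on_Times_nonneg f g) auto
  then show summable: "(\<lambda>(x, y). f x * g y) summable_on A \<times> B"
    by (rule summable_on_norm_bound) (auto simp: norm_mult)
  have "infsum (\<lambda>(x, y). f x * g y) (A \<times> B) = (\<Sum>\<^sub>\<infinity>x\<in>A. \<Sum>\<^sub>\<infinity>y\<in>B. f x * g y)"
    by (rule infsum_Sigma'_banach[OF summable, symmetric])
  then show "infsum (\<lambda>(x, y). f x * g y) (A \<times> B) = infsum f A * infsum g B"
    by (simp add: infsum_cmult_right' infsum_cmult_left')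
qed

text \<open>
  Transfers convergence and value from a series whose terms are entire expressions to a bilateral
  hypergeometric series, which differs from it by the nonzero constant \<open>C\<close>.
\<close>

lemma summable_infsum_of_cmult_eq:
  fixes f g :: "'a \<Rightarrow> complex"
  assumes "\<And>n. C * f n = g n" "C \<noteq> 0" "g summable_on A"
  shows "f summable_on A" and "C * infsum f A = infsum g A"
proof -
  have "f = (\<lambda>n. inverse C * g n)"
    using assms(1,2) by (auto simp: fun_eq_iff field_simps)
  then show "f summable_on A"
    using summable_on_cmult_right[OF assms(3)] by simp
  show "C * infsum f A = infsum g A"
    using assms(1) by (simp flip: infsum_cmult_right')
qed

section \<open>The infinite \<open>q\<close>-Pochhammer symbol\<close>

locale nome =
  fixes q :: complex
  assumes q_nz: "q \<noteq> 0" and norm_q: "norm q < 1"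
begin

abbreviation P :: "complex \<Rightarrow> complex" where "P \<equiv> qpoch_inf q"

definition Pfin :: "complex \<Rightarrow> nat \<Rightarrow> complex" where
  "Pfin z m = (\<Prod>j<m. 1 - z * q ^ j)"

text \<open>
  The reciprocal \<open>1 / (q; q)\<^sub>k\<close> of the \<open>q\<close>-factorial.
\<close>

definition rfac :: "nat \<Rightarrow> complex" where "rfac k = 1 / Pfin q k"

lemma convergent_prod_P: "convergent_prod (\<lambda>j. 1 - z * q ^ j)"
proof (intro abs_convergent_prod_imp_convergent_prod summable_imp_abs_convergent_prod)
  have "summable (\<lambda>j. norm z * norm q ^ j)"
    using norm_q by (intro summable_mult summable_geometric) simp
  then show "summable (\<lambda>j. norm (1 - z * q ^ j - 1))"
    by (simp add: norm_mult norm_power)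
qed

lemma Pfin_tendsto_P: "Pfin z \<longlonglongrightarrow> P z"
proof -
  have "(\<lambda>n. Pfin z (Suc n)) \<longlonglongrightarrow> P z"
    using convergent_prod_LIMSEQ[OF convergent_prod_P[of z]]
    by (simp add: Pfin_def qpoch_inf_def lessThan_Suc_atMost)
  then show ?thesis
    by (rule LIMSEQ_imp_Suc)
qed

lemma Pfin_Suc_shift: "Pfin z (Suc m) = (1 - z) * Pfin (z * q) m"
  unfolding Pfin_def by (subst prod.lessThan_Suc_shift) (simp add: mult.assoc)

lemma P_shift: "P z = (1 - z) * P (z * q)"
proof (rule LIMSEQ_unique)
  show "(\<lambda>m. Pfin z (Suc m)) \<longlonglongrightarrow> P z"
    using Pfin_tendsto_P by (rule LIMSEQ_Suc)
  show "(\<lambda>m. Pfin z (Suc m)) \<longlonglongrightarrow> (1 - z) * P (z * q)"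
    unfolding Pfin_Suc_shift by (intro tendsto_intros Pfin_tendsto_P)
qed

lemma P_0 [simp]: "P 0 = 1"
  by (simp add: qpoch_inf_def)

lemma P_nz:
  assumes "z \<notin> range (\<lambda>n::int. q powi n)"
  shows "P z \<noteq> 0"
  unfolding qpoch_inf_def
proof (rule prodinf_nonzero[OF convergent_prod_P])
  fix j
  show "1 - z * q ^ j \<noteq> 0"
  proof
    assume "1 - z * q ^ j = 0"
    then have "z = q powi (- int j)"
      using q_nz by (simp add: power_int_minus field_simps)
    with assms show False by blast
  qed
qed

lemma q_power_ne_1: "q ^ Suc j \<noteq> 1"
  using power_less_one_iff[of "norm q" "Suc j"] norm_q
  by (metis less_irrefl norm_ge_zero norm_one norm_power zero_less_Suc)

lemma Pq_nz: "P q \<noteq> 0"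
  unfolding qpoch_inf_def
  using prodinf_nonzero[OF convergent_prod_P] q_power_ne_1 by fastforce

lemma Pfin_q_nz: "Pfin q k \<noteq> 0"
  using q_power_ne_1 by (auto simp: Pfin_def)

lemma rfac_0 [simp]: "rfac 0 = 1"
  by (simp add: rfac_def Pfin_def)

lemma rfac_Suc: "(1 - q ^ Suc k) * rfac (Suc k) = rfac k"
  using q_power_ne_1[of k] by (simp add: rfac_def Pfin_def)

lemma rfac_bounded: obtains B where "B > 0" "\<And>k. norm (rfac k) \<le> B"
proof -
  have "rfac \<longlonglongrightarrow> 1 / P q"
    unfolding rfac_def by (intro tendsto_intros Pfin_tendsto_P Pq_nz)
  then have "Bseq rfac"
    by (intro convergent_imp_Bseq convergentI)
  then show ?thesis
    using that by (auto simp: Bseq_def)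
qed

lemma Pfin_bounded: obtains B where "B > 0" "\<And>k. norm (Pfin z k) \<le> B"
proof -
  have "Bseq (Pfin z)"
    using Pfin_tendsto_P by (intro convergent_imp_Bseq convergentI)
  then show ?thesis
    using that by (auto simp: Bseq_def)
qed

text \<open>
  The number \<open>c\<close> with \<open>|q| = exp (- c)\<close>: estimates are made on exponents, where every power of
  \<open>q\<close>, \<open>x\<close>, \<open>y\<close>, \<open>a\<close> becomes a summand.
\<close>

definition c :: real where "c = - ln (norm q)"

lemma c_pos: "c > 0"
  using q_nz norm_q by (simp add: c_def)

lemma norm_q_exp: "norm q = exp (- c)"
  using q_nz by (simp add: c_def)

section \<open>Euler's expansion\<close>

definition euler_term :: "complex \<Rightarrow> nat \<Rightarrow> complex" where
  "euler_term z k = (- z) ^ k * q ^ (k choose 2) * rfac k"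

lemma euler_abs_summable: "(\<lambda>k. norm (euler_term z k)) summable_on UNIV"
proof (cases "z = 0")
  case True
  then have "summable (\<lambda>k. norm (euler_term z k))"
    by (intro summable_finite[of "{0}"]) (auto simp: euler_term_def)
  then show ?thesis
    by (intro summable_nonneg_imp_summable_on) auto
next
  case False
  obtain B where B: "B > 0" "\<And>k. norm (rfac k) \<le> B"
    using rfac_bounded by blast
  define Z where "Z = ln (norm z)"
  have Z: "norm z = exp Z"
    using False by (simp add: Z_def)
  have eq: "norm (euler_term z k) =
      exp ((Z + c / 2) * of_nat k - (c / 2) * (of_nat k)\<^sup>2) * norm (rfac k)" for k
  proof -
    have "norm (euler_term z k) = exp (of_nat k * Z + of_nat (k choose 2) * (- c)) * norm (rfac k)"
      by (simp only: euler_term_def norm_mult norm_power norm_minus_cancel Z norm_q_exp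
          exp_add exp_of_nat_mult)
    also have "of_nat k * Z + of_nat (k choose 2) * (- c)
        = (Z + c / 2) * of_nat k - (c / 2) * (of_nat k)\<^sup>2"
      unfolding of_nat_choose_two by (simp add: power2_eq_square field_simps)
    finally show ?thesis .
  qed
  show ?thesis
  proof (rule summable_on_comparison_test)
    show "(\<lambda>k. exp ((Z + c / 2) * of_nat k - (c / 2) * (of_nat k)\<^sup>2) * B) summable_on UNIV"
      using c_pos by (intro summable_on_cmult_left summable_on_nat_gauss) simp
  qed (use B in \<open>auto simp: eq intro!: mult_left_mono\<close>)
qed

lemma euler_summable: "euler_term z summable_on UNIV"
  by (rule abs_summable_summable[OF euler_abs_summable])

text \<open>
  The series \<open>E\<close> satisfies \<open>E z = (1 - z) * E (z q)\<close>: subtracting the two series cancels the last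
  factor of each \<open>(q; q)\<^sub>k\<close>. Iterating gives \<open>E z = (z; q)\<^sub>m * E (z q^m)\<close>, and \<open>E\<close> is continuous at \<open>0\<close>
  with value \<open>1\<close> there, so the limit \<open>m \<rightarrow> \<infinity>\<close> identifies it with \<open>P\<close>. This route also covers the
  zeros of \<open>P\<close>.
\<close>

lemma euler: "infsum (euler_term z) UNIV = P z"
proof -
  define E where "E z = infsum (euler_term z) UNIV" for z
  have E_eq: "E z = (1 - z) * E (z * q)" for z
  proof -
    have sums: "euler_term z sums E z" for z
      using has_sum_imp_sums[OF has_sum_infsum[OF euler_summable]] by (simp add: E_def)
    have "(\<lambda>k. euler_term z k - euler_term (z * q) k) sums (E z - E (z * q))"
      by (intro sums_diff sums)
    then have "(\<lambda>k. euler_term z (Suc k) - euler_term (z * q) (Suc k)) sums (E z - E (z * q))"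
      by (subst sums_Suc_iff) (simp add: euler_term_def)
    also have "(\<lambda>k. euler_term z (Suc k) - euler_term (z * q) (Suc k))
        = (\<lambda>k. - z * euler_term (z * q) k)"
    proof
      fix k
      have pow: "(- (z * q)) ^ k = (- z) ^ k * q ^ k" for k
        using power_mult_distrib[of "- z" q k] by simp
      have "euler_term z (Suc k) - euler_term (z * q) (Suc k)
          = (- z) ^ Suc k * q ^ (Suc k choose 2) * ((1 - q ^ Suc k) * rfac (Suc k))"
        unfolding euler_term_def pow by (simp add: algebra_simps)
      also have "\<dots> = - z * euler_term (z * q) k"
        unfolding rfac_Suc by (simp add: euler_term_def pow numeral_2_eq_2 power_add)
      finally show "euler_term z (Suc k) - euler_term (z * q) (Suc k) = - z * euler_term (z * q) k" .
    qed
    finally have "E z - E (z * q) = - z * E (z * q)"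
      using sums_mult[OF sums, of "- z" "z * q"] sums_unique2 by blast
    then show ?thesis
      by (simp add: algebra_simps)
  qed
  have E_iter: "E z = Pfin z m * E (z * q ^ m)" for z m
  proof (induction m arbitrary: z)
    case (Suc m)
    show ?case
      by (subst E_eq, subst Suc.IH) (simp add: Pfin_Suc_shift mult.assoc)
  qed (simp add: Pfin_def)
  have E_cont: "E \<midarrow>0\<rightarrow> 1"
  proof -
    have "E \<midarrow>0\<rightarrow> (\<lambda>k. (-1) ^ k * q ^ (k choose 2) * rfac k) 0"
    proof (rule powser_limit_0[OF zero_less_one])
      show "(\<lambda>k. (-1) ^ k * q ^ (k choose 2) * rfac k * z ^ k) sums E z" for z
        using has_sum_imp_sums[OF has_sum_infsum[OF euler_summable[of z]]]
        unfolding E_def by (simp add: euler_term_def[abs_def] power_minus[of z] mult_ac)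
    qed
    then show ?thesis
      by (simp add: numeral_2_eq_2)
  qed
  show ?thesis
  proof (cases "z = 0")
    case True
    have "E 0 = infsum (euler_term 0) {0}"
      unfolding E_def by (rule infsum_cong_neutral) (auto simp: euler_term_def)
    then show ?thesis
      using True by (simp add: E_def euler_term_def numeral_2_eq_2)
  next
    case False
    have "(\<lambda>m. z * q ^ m) \<longlonglongrightarrow> z * 0"
      by (intro tendsto_intros LIMSEQ_power_zero norm_q)
    then have "filterlim (\<lambda>m. z * q ^ m) (at 0) sequentially"
      using False q_nz by (auto simp: filterlim_at)
    then have "(\<lambda>m. E (z * q ^ m)) \<longlonglongrightarrow> 1"
      by (rule filterlim_compose[OF E_cont])
    then have "(\<lambda>m. Pfin z m * E (z * q ^ m)) \<longlonglongrightarrow> P z * 1"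
      by (intro tendsto_mult Pfin_tendsto_P)
    then have "E z = P z"
      unfolding E_iter[symmetric] by (simp add: LIMSEQ_const_iff)
    then show ?thesis
      by (simp add: E_def)
  qed
qed

lemma P_bounded: obtains B where "B > 0" "\<And>z. norm z \<le> R \<Longrightarrow> norm (P z) \<le> B"
proof -
  define B where "B = (\<Sum>\<^sub>\<infinity>k. norm (euler_term (of_real R) k))"
  have "norm (P z) \<le> B" if "norm z \<le> R" for z
  proof -
    have "norm (P z) \<le> (\<Sum>\<^sub>\<infinity>k. norm (euler_term z k))"
      unfolding euler[symmetric] by (rule norm_infsum_bound[OF euler_abs_summable])
    also have "\<dots> \<le> B"
      unfolding B_def
    proof (rule infsum_mono[OF euler_abs_summable euler_abs_summable])
      fix k
      have "norm z \<le> \<bar>R\<bar>"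
        using that by simp
      then show "norm (euler_term z k) \<le> norm (euler_term (of_real R) k)"
        by (auto simp: euler_term_def norm_mult norm_power intro!: mult_right_mono power_mono)
    qed
    finally show ?thesis .
  qed
  then show ?thesis
    using that[of "\<bar>B\<bar> + 1"] by fastforce
qed

section \<open>Shifting the theta function\<close>

lemma triangle_Suc: "(n + 1) * (n + 1 - 1) div 2 = n * (n - 1) div 2 + (n :: int)"
proof -
  have "(n + 1) * (n + 1 - 1) = n * (n - 1) + n * 2"
    by (simp add: algebra_simps)
  then show ?thesis
    by (metis div_mult_self1 zero_neq_numeral add.commute)
qed

text \<open>
  Passing from \<open>n\<close> to \<open>n + 1\<close> moves the factor \<open>1 - z q^n\<close> out of the first product and the factor
  \<open>1 - q^(-n) / z\<close> into the second one; their quotient \<open>- z q^n\<close> is exactly the change of the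
  prefactor.
\<close>

lemma theta_shift:
  assumes "z \<noteq> 0"
  shows "P z * P (q / z) = (- z) powi n * q powi (n * (n - 1) div 2)
    * (P (z * q powi n) * P (q powi (1 - n) / z))"
proof -
  define g where "g n = (- z) powi n * q powi (n * (n - 1) div 2)
    * (P (z * q powi n) * P (q powi (1 - n) / z))" for n :: int
  have step: "g (n + 1) = g n" for n
  proof -
    have 1: "P (z * q powi n) = (1 - z * q powi n) * P (z * q powi (n + 1))"
      by (subst P_shift) (simp add: power_int_add q_nz mult.assoc)
    have 2: "P (q powi (- n) / z) = (1 - q powi (- n) / z) * P (q powi (1 - n) / z)"
      by (subst P_shift) (simp add: power_int_add power_int_diff power_int_minus q_nz divide_simps)
    have "g (n + 1) = (- z) powi n * q powi (n * (n - 1) div 2)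
        * ((- z * q powi n * (1 - q powi (- n) / z)) * P (z * q powi (n + 1)) * P (q powi (1 - n) / z))"
      unfolding g_def triangle_Suc using 2 assms q_nz by (simp add: power_int_add)
    also have "- z * q powi n * (1 - q powi (- n) / z) = 1 - z * q powi n"
      using assms q_nz by (simp add: power_int_minus field_simps)
    finally show ?thesis
      using 1 by (simp add: g_def)
  qed
  have "g n = g 0"
  proof (induction n rule: int_induct[where k = 0])
    case (step2 i)
    then show ?case using step[of "i - 1"] by simp
  qed (use step in auto)
  then show ?thesis
    by (simp add: g_def)
qed

section \<open>The symmetric function behind all four series\<close>

definition H_term :: "complex \<Rightarrow> complex \<Rightarrow> complex \<Rightarrow> int \<Rightarrow> complex" where
  "H_term x y a n = (x * y / a) powi n * q powi (n * (n - 1))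
     * (P (x * q powi n) * P (a * q powi (1 - n) / x))"

definition H :: "complex \<Rightarrow> complex \<Rightarrow> complex \<Rightarrow> complex" where
  "H x y a = infsum (H_term x y a) UNIV"

definition Phi_term :: "complex \<Rightarrow> complex \<Rightarrow> nat \<times> nat \<Rightarrow> complex" where
  "Phi_term X Y = (\<lambda>(k, l). (- X) ^ k * (- Y) ^ l * q ^ ((k + l) choose 2) * (rfac k * rfac l))"

definition Phi :: "complex \<Rightarrow> complex \<Rightarrow> complex" where
  "Phi X Y = infsum (Phi_term X Y) UNIV"

lemma Phi_commute: "Phi X Y = Phi Y X"
proof -
  have "Phi X Y = (\<Sum>\<^sub>\<infinity>p. Phi_term X Y (prod.swap p))"
    unfolding Phi_def by (rule infsum_reindex_bij_betw[symmetric]) (rule bij_swap)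
  also have "(\<lambda>p. Phi_term X Y (prod.swap p)) = Phi_term Y X"
    by (auto simp: Phi_term_def add.commute mult_ac)
  finally show ?thesis
    by (simp add: Phi_def)
qed

text \<open>
  The term of the expanded series, with \<open>n\<close> already shifted; the pair \<open>p\<close> is \<open>(k, l)\<close>.
\<close>

definition lattice_term :: "complex \<Rightarrow> complex \<Rightarrow> complex \<Rightarrow> int \<times> nat \<times> nat \<Rightarrow> complex" where
  "lattice_term x y a = (\<lambda>(n, p). (x * y / a) powi n * q powi (n * (n - 1))
     * Phi_term (x * q powi n) (y * q powi n) p)"

text \<open>
  The exponent of \<open>|q|\<close> has leading part \<open>n\<^sup>2 + n (k + l) + (k + l)\<^sup>2 / 2\<close>, which is positive
  definite and dominates \<open>(n\<^sup>2 + k\<^sup>2 + l\<^sup>2) / 8\<close> for \<open>k, l \<ge> 0\<close>. So the terms are bounded by a product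
  of three one-dimensional Gaussians \<open>f n\<close>, \<open>g X k\<close>, \<open>g Y l\<close>.
\<close>

lemma lattice_summable:
  assumes "x \<noteq> 0" "y \<noteq> 0" "a \<noteq> 0"
  shows "lattice_term x y a summable_on UNIV"
proof -
  obtain B where B: "B > 0" "\<And>k. norm (rfac k) \<le> B"
    using rfac_bounded by blast
  define X Y A where "X = ln (norm x)" and "Y = ln (norm y)" and "A = ln (norm (x * y / a))"
  have X: "norm x = exp X" and Y: "norm y = exp Y" and A: "norm (x * y / a) = exp A"
    using assms by (simp_all add: X_def Y_def A_def)
  define f where "f n = exp ((A + c) * of_int n - (c / 8) * (of_int n)\<^sup>2)" for n :: int
  define g where "g Z k = exp ((Z + c / 2) * of_nat k - (c / 8) * (of_nat k)\<^sup>2)"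
    for Z and k :: nat
  have g: "g Z summable_on UNIV" for Z
    using summable_on_nat_gauss[of "c / 8" "Z + c / 2"] c_pos by (simp add: g_def[abs_def])
  have f: "f summable_on UNIV"
    using summable_on_int_gauss[of "c / 8" "A + c"] c_pos by (simp add: f_def[abs_def])
  have "(\<lambda>(n, k, l). f n * (g X k * g Y l)) summable_on UNIV \<times> UNIV \<times> UNIV"
  proof -
    have gg: "(\<lambda>(k, l). g X k * g Y l) summable_on UNIV \<times> UNIV"
      by (intro summable_on_Times_nonneg g) (auto simp: g_def)
    have "(\<lambda>(n, p). f n * (case p of (k, l) \<Rightarrow> g X k * g Y l)) summable_on UNIV \<times> UNIV \<times> UNIV"
      by (rule summable_on_Times_nonneg[OF f gg]) (auto simp: f_def g_def)
    then show ?thesis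
      by (simp add: case_prod_unfold)
  qed
  then have sum: "(\<lambda>(n, k, l). (B * B) * (f n * (g X k * g Y l))) summable_on UNIV"
    using summable_on_cmult_right[where c = "B * B"] by (simp add: case_prod_unfold)
  show ?thesis
  proof (rule summable_on_norm_bound[OF sum])
    fix t :: "int \<times> nat \<times> nat"
    obtain n k l where t: "t = (n, k, l)"
      by (cases t) auto
    define N K L where "N = real_of_int n" and "K = real k" and "L = real l"
    have qn: "exp (- c) powi n = exp (- (c * N))"
      by (simp add: exp_power_int N_def mult.commute)
    have Kn: "norm (x * q powi n) = exp (X - c * N)" and Ln: "norm (y * q powi n) = exp (Y - c * N)"
      unfolding norm_mult norm_power_int X Y norm_q_exp qn by (simp_all flip: exp_add)
    have "norm (lattice_term x y a t) =
        exp (N * A) * exp (N * (N - 1) * (- c)) * exp (K * (X - c * N)) * exp (L * (Y - c * N))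
        * exp (((K + L) * (K + L - 1) / 2) * (- c)) * (norm (rfac k) * norm (rfac l))"
    proof -
      have 1: "norm ((x * y / a) powi n) = exp (N * A)"
        by (simp add: norm_power_int A exp_power_int N_def del: norm_divide norm_mult)
      have 2: "norm (q powi (n * (n - 1))) = exp (N * (N - 1) * (- c))"
        by (simp add: norm_power_int norm_q_exp exp_power_int N_def)
      have 3: "norm (q ^ ((k + l) choose 2)) = exp (((K + L) * (K + L - 1) / 2) * (- c))"
      proof -
        have "norm (q ^ ((k + l) choose 2)) = exp (of_nat ((k + l) choose 2) * (- c))"
          by (simp only: norm_power norm_q_exp exp_of_nat_mult)
        then show ?thesis
          by (simp add: of_nat_choose_two K_def L_def)
      qed
      have 4: "norm ((- (x * q powi n)) ^ k) = exp (K * (X - c * N))"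
        "norm ((- (y * q powi n)) ^ l) = exp (L * (Y - c * N))"
        unfolding norm_power norm_minus_cancel Kn Ln K_def L_def exp_of_nat_mult by simp_all
      show ?thesis
        unfolding t lattice_term_def Phi_term_def prod.case norm_mult[of _ "_ * _"] 
        by (simp only: norm_mult[of "_ powi _"] norm_mult[of "_ ^ _"] norm_mult[of "_ * _"]
            norm_mult[of "rfac _"] 1 2 3 4 mult.assoc)
    qed
    also have "\<dots> = exp (N * A + N * (N - 1) * (- c) + K * (X - c * N) + L * (Y - c * N)
        + ((K + L) * (K + L - 1) / 2) * (- c)) * (norm (rfac k) * norm (rfac l))"
      by (simp only: exp_add)
    also have "\<dots> \<le> exp (((A + c) * N - c / 8 * N\<^sup>2) + (((X + c / 2) * K - c / 8 * K\<^sup>2)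
        + ((Y + c / 2) * L - c / 8 * L\<^sup>2))) * (B * B)"
    proof (intro mult_mono)
      \<comment> \<open>the difference of the two quadratic forms, as a sum of nonnegative terms\<close>
      have "0 \<le> 7 / 8 * (N + 4 / 7 * (K + L))\<^sup>2 + 5 / 56 * (K + L)\<^sup>2 + 1 / 4 * (K * L)"
        by (simp add: K_def L_def)
      also have "\<dots> = (N\<^sup>2 + N * (K + L) + (K + L)\<^sup>2 / 2) - (N\<^sup>2 + K\<^sup>2 + L\<^sup>2) / 8"
        by (simp add: power2_eq_square field_simps)
      finally have "c * ((N\<^sup>2 + K\<^sup>2 + L\<^sup>2) / 8) \<le> c * (N\<^sup>2 + N * (K + L) + (K + L)\<^sup>2 / 2)"
        using c_pos by simp
      then show "exp (N * A + N * (N - 1) * (- c) + K * (X - c * N) + L * (Y - c * N)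
        + ((K + L) * (K + L - 1) / 2) * (- c)) \<le> exp (((A + c) * N - c / 8 * N\<^sup>2) 
        + (((X + c / 2) * K - c / 8 * K\<^sup>2) + ((Y + c / 2) * L - c / 8 * L\<^sup>2)))"
        by (simp add: power2_eq_square field_simps)
    qed (use B in \<open>auto intro: less_imp_le\<close>)
    also have "\<dots> = (case t of (n, k, l) \<Rightarrow> (B * B) * (f n * (g X k * g Y l)))"
      by (simp add: t f_def g_def N_def K_def L_def exp_add)
    finally show "norm (lattice_term x y a t) \<le> (case t of (n, k, l) \<Rightarrow> (B * B) * (f n * (g X k * g Y l)))" .
  qed
qed

text \<open>
  The series \<open>H\<close> with both infinite products expanded; \<open>k\<close> belongs to \<open>P (x q^n)\<close> and \<open>l\<close> to
  \<open>P (a q^(1-n) / x)\<close>.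
\<close>

definition H_expanded :: "complex \<Rightarrow> complex \<Rightarrow> complex \<Rightarrow> int \<times> nat \<times> nat \<Rightarrow> complex" where
  "H_expanded x y a = (\<lambda>(n, k, l). (x * y / a) powi n * q powi (n * (n - 1))
     * (euler_term (x * q powi n) k * euler_term (a * q powi (1 - n) / x) l))"

text \<open>
  With all quantities written as exponentials, this is an identity between polynomials in the
  exponents. Replacing \<open>n\<close> by \<open>n + l\<close> absorbs \<open>(a / x)^l\<close> into \<open>(x y / a)^l\<close>, leaving \<open>y^l\<close>, and
  produces the cross term \<open>k l\<close> that merges \<open>k choose 2\<close> and \<open>l choose 2\<close> into \<open>(k + l) choose 2\<close>.
\<close>

lemma H_expanded_shift:
  assumes "x \<noteq> 0" "y \<noteq> 0" "a \<noteq> 0"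
  shows "H_expanded x y a (n + int l, k, l) = lattice_term x y a (n, k, l)"
proof -
  obtain X Y A Q where X: "x = exp X" and Y: "y = exp Y" and A: "a = exp A" and Q: "q = exp Q"
    using assms q_nz by (metis exp_Ln)
  define N K L where "N = (of_int n :: complex)" and "K = (of_nat k :: complex)"
    and "L = (of_nat l :: complex)"
  have xya: "x * y / a = exp (X + Y - A)"
    by (simp add: X Y A exp_add exp_diff)
  have q: "q powi m = exp (of_int m * Q)" "q ^ j = exp (of_nat j * Q)" for m j
    by (simp_all add: Q exp_power_int exp_of_nat_mult)
  have pow: "(- exp Z) ^ j = (-1) ^ j * exp (of_nat j * Z)" for Z :: complex and j
    by (subst power_minus) (simp add: exp_of_nat_mult)
  have x1: "x * exp Z = exp (X + Z)" "y * exp Z = exp (Y + Z)" "a * exp Z / x = exp (A + Z - X)" for Z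
    by (simp_all add: X Y A exp_add exp_diff)
  have "H_expanded x y a (n + int l, k, l) = (-1) ^ k * (-1) ^ l * (rfac k * rfac l) *
    exp ((N + L) * (X + Y - A) + (N + L) * (N + L - 1) * Q + K * (X + (N + L) * Q)
      + (K * (K - 1) / 2) * Q + L * (A + (1 - (N + L)) * Q - X) + (L * (L - 1) / 2) * Q)"
    unfolding H_expanded_def euler_term_def prod.case xya q exp_power_int x1 pow of_nat_choose_two
    by (simp add: N_def K_def L_def exp_add mult_ac)
  also have "(N + L) * (X + Y - A) + (N + L) * (N + L - 1) * Q + K * (X + (N + L) * Q)
      + (K * (K - 1) / 2) * Q + L * (A + (1 - (N + L)) * Q - X) + (L * (L - 1) / 2) * Q
    = N * (X + Y - A) + N * (N - 1) * Q + K * (X + N * Q) + L * (Y + N * Q)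
      + ((K + L) * (K + L - 1) / 2) * Q"
    by (simp add: field_simps)
  also have "(-1) ^ k * (-1) ^ l * (rfac k * rfac l) * exp \<dots> = lattice_term x y a (n, k, l)"
    unfolding lattice_term_def Phi_term_def prod.case xya q exp_power_int x1 pow of_nat_choose_two
    by (simp add: N_def K_def L_def exp_add mult_ac)
  finally show ?thesis .
qed

text \<open>
  The triple series is summed over \<open>(k, l)\<close> first, in both of its forms: before the shift of \<open>n\<close> the
  inner sum is a product of two Euler expansions and the result is \<open>H\<close>; after the shift the inner
  sum is \<open>\<Phi> (x q^n, y q^n)\<close>.
\<close>

lemma
  assumes "x \<noteq> 0" "y \<noteq> 0" "a \<noteq> 0"
  shows H_summable: "H_term x y a summable_on UNIV"
    and H_eq_Phi: "H x y a = (\<Sum>\<^sub>\<infinity>n. (x * y / a) powi n * q powi (n * (n - 1))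
      * Phi (x * q powi n) (y * q powi n))"
proof -
  let ?g = "\<lambda>(n :: int, k :: nat, l :: nat). (n + int l, k, l)"
  have bij: "bij_betw ?g UNIV UNIV"
    by (rule bij_betwI[where g = "\<lambda>(n, k, l). (n - int l, k, l)"]) auto
  have shift: "(\<lambda>t. H_expanded x y a (?g t)) = lattice_term x y a"
    using H_expanded_shift[OF assms] by (auto simp: fun_eq_iff)
  have summable: "H_expanded x y a summable_on UNIV \<times> UNIV"
    using summable_on_reindex_bij_betw[OF bij, of "H_expanded x y a"] lattice_summable[OF assms] shift
    by simp
  have inner: "(\<Sum>\<^sub>\<infinity>p. H_expanded x y a (n, p)) = H_term x y a n" for n
    using infsum_Times_product(2)[OF euler_abs_summable euler_abs_summable,
        of "x * q powi n" "a * q powi (1 - n) / x"]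
    by (simp add: H_expanded_def H_term_def case_prod_unfold infsum_cmult_right' euler)
  show "H_term x y a summable_on UNIV"
    using summable_on_Sigma_banach[of "\<lambda>n p. H_expanded x y a (n, p)" UNIV "\<lambda>_. UNIV"]
      summable inner by simp
  have "H x y a = infsum (H_expanded x y a) UNIV"
    using infsum_Sigma_banach[OF summable] by (simp add: inner H_def)
  also have "\<dots> = infsum (lattice_term x y a) UNIV"
    using infsum_reindex_bij_betw[OF bij, of "H_expanded x y a"] shift by simp
  also have "\<dots> = (\<Sum>\<^sub>\<infinity>n. \<Sum>\<^sub>\<infinity>p. lattice_term x y a (n, p))"
    using infsum_Sigma_banach[of "lattice_term x y a" UNIV "\<lambda>_. UNIV"] lattice_summable[OF assms] by simp
  also have "\<dots> = (\<Sum>\<^sub>\<infinity>n. (x * y / a) powi n * q powi (n * (n - 1))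
      * Phi (x * q powi n) (y * q powi n))"
    by (simp add: lattice_term_def Phi_def infsum_cmult_right')
  finally show "H x y a = (\<Sum>\<^sub>\<infinity>n. (x * y / a) powi n * q powi (n * (n - 1))
      * Phi (x * q powi n) (y * q powi n))" .
qed

lemma H_commute:
  assumes "x \<noteq> 0" "y \<noteq> 0" "a \<noteq> 0"
  shows "H x y a = H y x a"
  using assms by (simp add: H_eq_Phi Phi_commute[of "x * _"] mult.commute[of x y])

lemma reflect_weight:
  assumes "x \<noteq> 0" "y \<noteq> 0" "a \<noteq> 0"
  shows "(a * q / x * (a * q / y) / a) powi (- n) * q powi (- n * (- n - 1))
    = (x * y / a) powi n * q powi (n * (n - 1))"
proof -
  have "(a * q / x * (a * q / y) / a) powi (- n) = (x * y / a) powi n * q powi (- 2 * n)"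
    using assms q_nz by (simp add: power_int_minus power_int_mult_distrib power_int_divide_distrib
        power_int_mult power2_eq_square field_simps)
  moreover have "q powi (- 2 * n) * q powi (- n * (- n - 1)) = q powi (n * (n - 1))"
    using q_nz by (simp add: algebra_simps flip: power_int_add)
  ultimately show ?thesis
    by (simp add: mult.assoc)
qed

lemma H_reflect:
  assumes "x \<noteq> 0" "y \<noteq> 0" "a \<noteq> 0"
  shows "H (a * q / x) (a * q / y) a = H x y a"
proof -
  have "H_term (a * q / x) (a * q / y) a (- n) = H_term x y a n" for n
  proof -
    have "a * q / x * q powi (- n) = a * q powi (1 - n) / x"
      using q_nz by (simp add: power_int_diff power_int_minus field_simps)
    moreover have "a * q powi (1 - - n) / (a * q / x) = x * q powi n"
      using q_nz assms by (simp add: power_int_add field_simps)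
    ultimately show ?thesis
      by (simp only: H_term_def reflect_weight[OF assms] mult.commute[of "P (x * _)"])
  qed
  then show ?thesis
    unfolding H_def
    using infsum_reindex_bij_betw[of uminus UNIV UNIV "H_term (a * q / x) (a * q / y) a"]
    by (simp add: bij_uminus)
qed

section \<open>A second expansion of \<open>\<Phi>\<close>\<close>

lemma choose_two_Suc: "Suc m choose 2 = m + (m choose 2)"
  by (simp add: numeral_2_eq_2)

lemma choose_two_add: "(m + j) choose 2 = (m choose 2) + (j choose 2) + m * j"
  by (induction m) (simp_all add: choose_two_Suc numeral_2_eq_2)

text \<open>
  Multiplied by \<open>(q; q)\<^sub>l\<close>, the coefficients become \<open>q\<close>-binomial coefficients. Let \<open>T l X\<close> be the
  left-hand side. Splitting
  \<open>1 - q^(l + 1) = q^m (1 - q^(l + 1 - m)) + (1 - q^m)\<close>, the \<open>q\<close>-Pascal rule, lowers one of the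
  two \<open>q\<close>-factorials in each part, and the parts recombine to
  \<open>(1 - q^(l + 1)) * T (l + 1) X = T l (X q)\<close>. So the statement reduces to \<open>l = 0\<close>.
\<close>

lemma sum_rfac_P:
  "(\<Sum>m\<le>l. rfac m * rfac (l - m) * X ^ m * q ^ (2 * (m choose 2)) * P (X * q ^ m)) = rfac l * P (X * q ^ l)"
proof (induction l arbitrary: X)
  case 0
  show ?case by (simp add: numeral_2_eq_2)
next
  case (Suc l)
  define t where "t m = rfac m * rfac (Suc l - m) * X ^ m * q ^ (2 * (m choose 2)) * P (X * q ^ m)" for m
  have "(1 - q ^ Suc l) * (\<Sum>m\<le>Suc l. t m)
      = (\<Sum>m\<le>Suc l. q ^ m * (1 - q ^ (Suc l - m)) * t m) + (\<Sum>m\<le>Suc l. (1 - q ^ m) * t m)"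
    unfolding sum_distrib_left sum.distrib[symmetric]
  proof (rule sum.cong[OF refl])
    fix m assume "m \<in> {..Suc l}"
    then have "q ^ Suc l = q ^ m * q ^ (Suc l - m)"
      by (simp flip: power_add)
    then show "(1 - q ^ Suc l) * t m = q ^ m * (1 - q ^ (Suc l - m)) * t m + (1 - q ^ m) * t m"
      by (simp only: algebra_simps mult_1_left)
  qed
  also have "(\<Sum>m\<le>Suc l. q ^ m * (1 - q ^ (Suc l - m)) * t m)
      = (\<Sum>m\<le>l. q ^ m * (1 - q ^ (Suc l - m)) * t m)"
    by simp
  also have "(\<Sum>m\<le>Suc l. (1 - q ^ m) * t m) = (\<Sum>m\<le>l. (1 - q ^ Suc m) * t (Suc m))"
    by (subst sum.atMost_Suc_shift) simp
  also have "(\<Sum>m\<le>l. q ^ m * (1 - q ^ (Suc l - m)) * t m) + (\<Sum>m\<le>l. (1 - q ^ Suc m) * t (Suc m))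
      = (\<Sum>m\<le>l. rfac m * rfac (l - m) * (X * q) ^ m * q ^ (2 * (m choose 2)) * P (X * q * q ^ m))"
    unfolding sum.distrib[symmetric]
  proof (rule sum.cong[OF refl])
    fix m assume "m \<in> {..l}"
    then have m: "Suc l - m = Suc (l - m)"
      by simp
    define w where "w = rfac m * rfac (l - m) * X ^ m * q ^ (2 * (m choose 2)) * q ^ m"
    have P: "P (X * q ^ m) = (1 - X * q ^ m) * P (X * q * q ^ m)"
      by (subst P_shift) (simp add: mult_ac)
    have "q ^ m * (1 - q ^ (Suc l - m)) * t m
        = rfac m * ((1 - q ^ Suc (l - m)) * rfac (Suc (l - m))) * X ^ m * q ^ (2 * (m choose 2)) * q ^ m
          * P (X * q ^ m)"
      unfolding t_def m by (simp only: mult_ac)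
    then have 1: "q ^ m * (1 - q ^ (Suc l - m)) * t m = w * P (X * q ^ m)"
      unfolding rfac_Suc w_def .
    have "(1 - q ^ Suc m) * t (Suc m)
        = ((1 - q ^ Suc m) * rfac (Suc m)) * rfac (l - m) * X ^ Suc m * q ^ (2 * (Suc m choose 2))
          * P (X * q * q ^ m)"
      by (simp add: t_def mult_ac)
    then have 2: "(1 - q ^ Suc m) * t (Suc m) = w * (X * q ^ m) * P (X * q * q ^ m)"
      unfolding rfac_Suc w_def choose_two_Suc distrib_left power_add mult_2 by (simp add: mult_ac)
    show "q ^ m * (1 - q ^ (Suc l - m)) * t m + (1 - q ^ Suc m) * t (Suc m)
        = rfac m * rfac (l - m) * (X * q) ^ m * q ^ (2 * (m choose 2)) * P (X * q * q ^ m)"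
      unfolding 1 2 P by (simp add: w_def power_mult_distrib algebra_simps)
  qed
  also have "\<dots> = rfac l * P (X * q * q ^ l)"
    by (rule Suc.IH)
  also have "\<dots> = (1 - q ^ Suc l) * (rfac (Suc l) * P (X * q ^ Suc l))"
    unfolding rfac_Suc[of l, symmetric] by (simp add: mult_ac)
  finally have "(\<Sum>m\<le>Suc l. t m) = rfac (Suc l) * P (X * q ^ Suc l)"
    using q_power_ne_1[of l] by (metis mult_cancel_left right_minus_eq)
  then show ?case
    by (simp only: t_def)
qed

definition psi_term :: "complex \<Rightarrow> complex \<Rightarrow> nat \<Rightarrow> complex" where
  "psi_term X Y m = (- (X * Y)) ^ m * q ^ (3 * (m choose 2)) * rfac m * (P (X * q ^ m) * P (Y * q ^ m))"

text \<open>
  The slice \<open>n = 0\<close>, \<open>a = 1\<close> of the triple series.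
\<close>

lemma Phi_summable:
  assumes "X \<noteq> 0" "Y \<noteq> 0"
  shows "Phi_term X Y summable_on UNIV \<times> UNIV"
proof -
  have "(\<lambda>(n, p). lattice_term X Y 1 (n, p)) summable_on UNIV \<times> UNIV"
    using lattice_summable[of X Y 1] assms by simp
  from summable_on_SigmaD1[OF this, of 0] show ?thesis
    by (simp add: lattice_term_def)
qed

lemma Phi_single_sum:
  assumes "X \<noteq> 0" "Y \<noteq> 0"
  shows "Phi X Y = (\<Sum>\<^sub>\<infinity>k. (- X) ^ k * q ^ (k choose 2) * (rfac k * P (Y * q ^ k)))"
proof -
  have "Phi X Y = (\<Sum>\<^sub>\<infinity>k. \<Sum>\<^sub>\<infinity>l. Phi_term X Y (k, l))"
    using infsum_Sigma_banach[OF Phi_summable[OF assms]] by (simp add: Phi_def)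
  also have "\<dots> = (\<Sum>\<^sub>\<infinity>k. (- X) ^ k * q ^ (k choose 2) * (rfac k * P (Y * q ^ k)))"
  proof (rule infsum_cong)
    fix k :: nat
    have "Phi_term X Y (k, l) = ((- X) ^ k * q ^ (k choose 2) * rfac k) * euler_term (Y * q ^ k) l" for l
    proof -
      have "(- (Y * q ^ k)) ^ l = (- Y) ^ l * q ^ (k * l)"
        using power_mult_distrib[of "- Y" "q ^ k" l] by (simp add: power_mult)
      then show ?thesis
        by (simp add: Phi_term_def euler_term_def choose_two_add power_add mult_ac)
    qed
    then have "(\<Sum>\<^sub>\<infinity>l. Phi_term X Y (k, l)) = ((- X) ^ k * q ^ (k choose 2) * rfac k) * P (Y * q ^ k)"
      by (simp only: infsum_cmult_right' euler)
    then show "(\<Sum>\<^sub>\<infinity>l. Phi_term X Y (k, l)) = (- X) ^ k * q ^ (k choose 2) * (rfac k * P (Y * q ^ k))"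
      by (simp only: mult.assoc)
  qed
  finally show ?thesis .
qed

text \<open>
  Euler's formula for \<open>P (X q^m)\<close> expands the right-hand side into a double series over \<open>(m, j)\<close>. On
  the antidiagonal \<open>m + j = k\<close> the terms add up, by \<open>sum_rfac_P\<close>, to the \<open>k\<close>-th term of
  \<open>Phi_single_sum\<close>.
\<close>

lemma Phi_eq_psi:
  assumes "X \<noteq> 0" "Y \<noteq> 0"
  shows "Phi X Y = infsum (psi_term X Y) UNIV"
proof -
  define u where "u = (\<lambda>(m, j). (- (X * Y)) ^ m * q ^ (3 * (m choose 2)) * rfac m * P (Y * q ^ m)
    * euler_term (X * q ^ m) j)"
  obtain B where B: "B > 0" "\<And>z. norm z \<le> norm Y \<Longrightarrow> norm (P z) \<le> B"
    using P_bounded by blast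
  have q_le: "norm q ^ j \<le> 1" for j
    using norm_q by (simp add: power_le_one)
  have "(\<lambda>(m, j). norm (euler_term (X * Y) m) * norm (euler_term X j)) summable_on UNIV \<times> UNIV"
    by (intro summable_on_Times_nonneg euler_abs_summable) auto
  then have "(\<lambda>(m, j). B * (norm (euler_term (X * Y) m) * norm (euler_term X j))) summable_on UNIV \<times> UNIV"
    using summable_on_cmult_right[where c = B] by (simp add: case_prod_unfold)
  then have u_summable: "u summable_on UNIV \<times> UNIV"
  proof (rule summable_on_norm_bound)
    fix p :: "nat \<times> nat"
    obtain m j where p: "p = (m, j)"
      by (cases p)
    have 1: "norm ((- (X * Y)) ^ m * q ^ (3 * (m choose 2)) * rfac m) \<le> norm (euler_term (X * Y) m)"
      using norm_q by (auto simp: euler_term_def norm_mult norm_power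
          intro!: mult_right_mono mult_left_mono power_decreasing)
    have "norm (Y * q ^ m) \<le> norm Y"
      using mult_left_mono[OF q_le[of m], of "norm Y"] by (simp add: norm_mult norm_power)
    then have 2: "norm (P (Y * q ^ m)) \<le> B"
      by (rule B)
    have "norm (X * q ^ m) \<le> norm X"
      using mult_left_mono[OF q_le[of m], of "norm X"] by (simp add: norm_mult norm_power)
    then have 3: "norm (euler_term (X * q ^ m) j) \<le> norm (euler_term X j)"
      unfolding euler_term_def norm_mult norm_power norm_minus_cancel
      by (intro mult_right_mono power_mono) auto
    have "norm (u p) = norm ((- (X * Y)) ^ m * q ^ (3 * (m choose 2)) * rfac m) * norm (P (Y * q ^ m))
        * norm (euler_term (X * q ^ m) j)"
      by (simp add: u_def p norm_mult)
    also have "\<dots> \<le> norm (euler_term (X * Y) m) * B * norm (euler_term X j)"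
      using B(1) by (intro mult_mono 1 2 3) auto
    finally show "norm (u p) \<le> (case p of (m, j) \<Rightarrow> B * (norm (euler_term (X * Y) m) * norm (euler_term X j)))"
      by (simp add: p mult_ac)
  qed
  have "(\<Sum>\<^sub>\<infinity>j. u (m, j)) = psi_term X Y m" for m
    unfolding u_def prod.case infsum_cmult_right' euler psi_term_def by (simp only: mult_ac)
  then have "infsum (psi_term X Y) UNIV = (\<Sum>\<^sub>\<infinity>m. \<Sum>\<^sub>\<infinity>j. u (m, j))"
    by simp
  also have "\<dots> = infsum u UNIV"
    using infsum_Sigma_banach[OF u_summable] by simp
  also have "\<dots> = (\<Sum>\<^sub>\<infinity>(k, m)\<in>(SIGMA k:UNIV. {..k}). u (m, k - m))"
    by (rule infsum_reindex_bij_witness[where i = "\<lambda>(k, m). (m, k - m)" and j = "\<lambda>(m, j). (m + j, m)"]) auto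
  also have "\<dots> = (\<Sum>\<^sub>\<infinity>k. \<Sum>m\<le>k. u (m, k - m))"
  proof -
    have "(\<lambda>(k, m). u (m, k - m)) summable_on (SIGMA k:UNIV. {..k})"
      using u_summable
      by (subst summable_on_reindex_bij_witness[where j = "\<lambda>(k, m). (m, k - m)" and i = "\<lambda>(m, j). (m + j, m)"
            and T = UNIV and h = u]) auto
    from infsum_Sigma'_banach[OF this] show ?thesis
      by simp
  qed
  also have "\<dots> = (\<Sum>\<^sub>\<infinity>k. (- X) ^ k * q ^ (k choose 2) * (rfac k * P (Y * q ^ k)))"
  proof (rule infsum_cong)
    fix k :: nat
    have "u (m, k - m) = (- X) ^ k * q ^ (k choose 2)
        * (rfac m * rfac (k - m) * Y ^ m * q ^ (2 * (m choose 2)) * P (Y * q ^ m))" if "m \<le> k" for m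
    proof -
      obtain j where k: "k = m + j"
        using \<open>m \<le> k\<close> le_Suc_ex by blast
      have 1: "(- (X * q ^ m)) ^ j = (- X) ^ j * q ^ (m * j)"
        using power_mult_distrib[of "- X" "q ^ m" j] by (simp add: power_mult)
      have 2: "(- (X * Y)) ^ m = (- X) ^ m * Y ^ m"
        using power_mult_distrib[of "- X" Y m] by simp
      have 3: "q ^ (3 * (m choose 2)) = q ^ (2 * (m choose 2)) * q ^ (m choose 2)"
        by (simp flip: power_add)
      show ?thesis
        unfolding u_def euler_term_def prod.case k diff_add_inverse choose_two_add power_add 1 2 3 by (simp add: mult_ac)
    qed
    then show "(\<Sum>m\<le>k. u (m, k - m)) = (- X) ^ k * q ^ (k choose 2) * (rfac k * P (Y * q ^ k))"
      unfolding sum_rfac_P[symmetric] sum_distrib_left by simp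
  qed
  also have "\<dots> = Phi X Y"
    by (rule Phi_single_sum[OF assms, symmetric])
  finally show ?thesis ..
qed

section \<open>The series \<open>K\<close> for \<open>|a| < 1\<close>\<close>

definition K_term :: "complex \<Rightarrow> complex \<Rightarrow> complex \<Rightarrow> int \<Rightarrow> complex" where
  "K_term x y a n = (x * y / a) powi n * q powi (n * (n - 1))
     * (P (x * q powi n) * P (y * q powi n))"

definition K :: "complex \<Rightarrow> complex \<Rightarrow> complex \<Rightarrow> complex" where
  "K x y a = infsum (K_term x y a) UNIV"

text \<open>
  Pulls out the growth of \<open>P (z q^(-m))\<close>. What remains is the finite product \<open>(q / z; q)\<^sub>m\<close>, which
  stays bounded in \<open>m\<close>; unlike \<open>theta_shift\<close>, this form needs no division by a product that may
  vanish.
\<close>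

lemma P_negative_shift:
  assumes "z \<noteq> 0"
  shows "q ^ (Suc m choose 2) * P (z * q powi (- int m)) = (- z) ^ m * P z * Pfin (q / z) m"
proof (induction m)
  case 0
  show ?case by (simp add: Pfin_def numeral_2_eq_2)
next
  case (Suc m)
  define w where "w = z * q powi (- int (Suc m))"
  have w: "w * q = z * q powi (- int m)" "w * q ^ Suc m = z"
    using q_nz unfolding w_def power_int_minus power_int_of_nat by (simp_all add: field_simps)
  have "q ^ (Suc (Suc m) choose 2) * P w
      = q ^ Suc m * (1 - w) * (q ^ (Suc m choose 2) * P (z * q powi (- int m)))"
    unfolding choose_two_Suc[of "Suc m"] power_add P_shift[of w] w by (simp only: mult_ac)
  also have "q ^ Suc m * (1 - w) = - z * (1 - q / z * q ^ m)"
    using w(2) assms by (simp add: field_simps)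
  finally show ?case
    unfolding Suc.IH w_def by (simp add: Pfin_def mult_ac)
qed

text \<open>
  Towards \<open>+\<infinity>\<close> the terms decay like a Gaussian. Towards \<open>-\<infinity>\<close> the growth of the two infinite
  products cancels \<open>q^(n(n-1))\<close>, and the terms are \<open>a^m\<close> times a bounded factor at \<open>n = -m\<close>; this is
  where \<open>|a| < 1\<close> enters.
\<close>

lemma K_summable:
  assumes "x \<noteq> 0" "y \<noteq> 0" "a \<noteq> 0" "norm a < 1"
  shows "K_term x y a summable_on UNIV"
proof -
  have "(\<lambda>k. K_term x y a (int k)) summable_on UNIV"
  proof -
    obtain Bx where Bx: "Bx > 0" "\<And>z. norm z \<le> norm x \<Longrightarrow> norm (P z) \<le> Bx"
      using P_bounded by blast
    obtain By where By: "By > 0" "\<And>z. norm z \<le> norm y \<Longrightarrow> norm (P z) \<le> By"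
      using P_bounded by blast
    define A where "A = ln (norm (x * y / a))"
    have A: "norm (x * y / a) = exp A"
      using assms by (simp add: A_def)
    have "(\<lambda>k::nat. exp ((A + c) * of_nat k - c * (of_nat k)\<^sup>2) * (Bx * By)) summable_on UNIV"
      by (intro summable_on_cmult_left summable_on_nat_gauss c_pos)
    then show ?thesis
    proof (rule summable_on_norm_bound)
      fix k :: nat
      have small: "norm (z * q powi int k) \<le> norm z" for z
        using norm_q by (auto simp: norm_mult norm_power power_le_one intro!: mult_left_le)
      have "norm (K_term x y a (int k)) = exp ((A + c) * of_nat k - c * (of_nat k)\<^sup>2)
          * (norm (P (x * q powi int k)) * norm (P (y * q powi int k)))"
      proof -
        have "norm ((x * y / a) powi int k) = exp (of_nat k * A)"
          by (simp only: norm_power_int A exp_power_int of_int_of_nat_eq)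
        moreover have "norm (q powi (int k * (int k - 1))) = exp (of_nat k * (of_nat k - 1) * (- c))"
          by (simp add: norm_power_int norm_q_exp exp_power_int)
        moreover have "of_nat k * A + of_nat k * (of_nat k - 1) * (- c)
            = (A + c) * of_nat k - c * (of_nat k)\<^sup>2"
          by (simp add: power2_eq_square algebra_simps)
        ultimately show ?thesis
          unfolding K_term_def norm_mult[of _ "_ * _"] norm_mult[of "_ powi _" "_ powi _"]
            norm_mult[of "P _"] by (metis exp_add)
      qed
      also have "\<dots> \<le> exp ((A + c) * of_nat k - c * (of_nat k)\<^sup>2) * (Bx * By)"
        using Bx(1) By(1) by (intro mult_left_mono mult_mono Bx(2) By(2) small) auto
      finally show "norm (K_term x y a (int k)) \<le> \<dots>" .
    qed
  qed
  then have pos: "K_term x y a summable_on range int"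
    by (subst summable_on_reindex) (auto simp: o_def)
  have "(\<lambda>m. K_term x y a (- int m)) summable_on UNIV"
  proof -
    obtain Bx where Bx: "Bx > 0" "\<And>m. norm (Pfin (q / x) m) \<le> Bx"
      using Pfin_bounded by blast
    obtain By where By: "By > 0" "\<And>m. norm (Pfin (q / y) m) \<le> By"
      using Pfin_bounded by blast
    have eq: "K_term x y a (- int m) = a ^ m * ((P x * P y) * (Pfin (q / x) m * Pfin (q / y) m))" for m
    proof -
      have "(- int m) * (- int m - 1) = int (Suc m choose 2) + int (Suc m choose 2)"
        by (induction m) (simp_all add: choose_two_Suc numeral_2_eq_2 algebra_simps)
      then have 1: "q powi ((- int m) * (- int m - 1)) = q ^ (Suc m choose 2) * q ^ (Suc m choose 2)"
        using q_nz by (simp only:) (subst power_int_add, auto)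
      have "K_term x y a (- int m) = (x * y / a) powi (- int m)
          * ((q ^ (Suc m choose 2) * P (x * q powi (- int m)))
          * (q ^ (Suc m choose 2) * P (y * q powi (- int m))))"
        unfolding K_term_def 1 by (simp only: mult_ac)
      also have "\<dots> = (x * y / a) powi (- int m) * ((- x) ^ m * (- y) ^ m)
          * ((P x * P y) * (Pfin (q / x) m * Pfin (q / y) m))"
        unfolding P_negative_shift[OF assms(1)] P_negative_shift[OF assms(2)] by (simp only: mult_ac)
      also have "(x * y / a) powi (- int m) * ((- x) ^ m * (- y) ^ m) = a ^ m"
        using assms by (simp add: power_int_minus power_divide power_mult_distrib field_simps
            flip: power_mult_distrib)
      finally show ?thesis .
    qed
    have "(\<lambda>m. norm a ^ m * (norm (P x * P y) * (Bx * By))) summable_on UNIV"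
      using assms(4)
      by (intro summable_on_cmult_left summable_nonneg_imp_summable_on summable_geometric) auto
    then show ?thesis
    proof (rule summable_on_norm_bound)
      fix m
      show "norm (K_term x y a (- int m)) \<le> norm a ^ m * (norm (P x * P y) * (Bx * By))"
        unfolding eq norm_mult norm_power
        using Bx By by (intro mult_left_mono mult_mono) (auto simp: less_imp_le)
    qed
  qed
  then have neg: "K_term x y a summable_on range (\<lambda>m. - int m)"
    by (subst summable_on_reindex) (auto simp: o_def inj_on_def)
  have "(UNIV :: int set) = range int \<union> range (\<lambda>m. - int m)"
    by (auto, metis int_cases2 rangeI)
  then show ?thesis
    using summable_on_union[OF pos neg] by simp
qed

text \<open>
  Euler's formula for \<open>P a\<close> makes \<open>P a * K\<close> a double series over \<open>(n, m)\<close>, absolutely convergent as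
  a product of two series. Replacing \<open>n\<close> by \<open>n + m\<close> cancels the power \<open>a^m\<close>, and the sum over \<open>m\<close>
  is then the second expansion of \<open>\<Phi> (x q^n, y q^n)\<close>.
\<close>

lemma H_eq_K:
  assumes "x \<noteq> 0" "y \<noteq> 0" "a \<noteq> 0" "norm a < 1"
  shows "H x y a = P a * K x y a"
proof -
  let ?f = "\<lambda>(n, m). K_term x y a n * euler_term a m"
  let ?g = "\<lambda>(n :: int, m :: nat). (n + int m, m)"
  have K_abs: "(\<lambda>n. norm (K_term x y a n)) summable_on UNIV"
    using K_summable[OF assms] by (simp add: summable_on_iff_abs_summable_on_complex)
  note prod = infsum_Times_product[OF K_abs euler_abs_summable[of a]]
  have bij: "bij_betw ?g UNIV UNIV"
    by (rule bij_betwI[where g = "\<lambda>(n, m). (n - int m, m)"]) auto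
  have shift: "?f (?g (n, m)) = (x * y / a) powi n * q powi (n * (n - 1))
      * psi_term (x * q powi n) (y * q powi n) m" for n m
  proof -
    obtain X Y A Q where X: "x = exp X" and Y: "y = exp Y" and A: "a = exp A" and Q: "q = exp Q"
      using assms q_nz by (metis exp_Ln)
    define N M where "N = (of_int n :: complex)" and "M = (of_nat m :: complex)"
    have xya: "x * y / a = exp (X + Y - A)"
      by (simp add: X Y A exp_add exp_diff)
    have q: "q powi m = exp (of_int m * Q)" "q ^ j = exp (of_nat j * Q)" for m j
      by (simp_all add: Q exp_power_int exp_of_nat_mult)
    have pow: "(- exp Z) ^ j = (-1) ^ j * exp (of_nat j * Z)" for Z :: complex and j
      by (subst power_minus) (simp add: exp_of_nat_mult)
    have pa: "(- a) ^ m = (-1) ^ m * exp (M * A)"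
      by (simp only: A pow M_def)
    define w where "w = (-1) ^ m * rfac m * (P (x * q powi (n + int m)) * P (y * q powi (n + int m)))"
    have "?f (?g (n, m)) = w * exp ((N + M) * (X + Y - A) + (N + M) * (N + M - 1) * Q + M * A
        + (M * (M - 1) / 2) * Q)"
      unfolding K_term_def euler_term_def prod.case w_def xya q exp_power_int pa of_nat_choose_two
      by (simp add: N_def M_def exp_add mult_ac)
    also have "(N + M) * (X + Y - A) + (N + M) * (N + M - 1) * Q + M * A + (M * (M - 1) / 2) * Q
      = N * (X + Y - A) + N * (N - 1) * Q + M * (X + N * Q + (Y + N * Q)) + 3 * (M * (M - 1) / 2) * Q"
      by (simp add: field_simps)
    also have "w * exp \<dots> = (x * y / a) powi n * q powi (n * (n - 1))
      * psi_term (x * q powi n) (y * q powi n) m"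
    proof -
      have P: "x * q powi n * q ^ m = x * q powi (n + int m)" "y * q powi n * q ^ m = y * q powi (n + int m)"
        using q_nz by (simp_all add: power_int_add)
      have xy: "x * q powi n * (y * q powi n) = exp (X + N * Q + (Y + N * Q))"
        unfolding X Y q N_def exp_add by (simp only: mult.assoc)
      have C: "q ^ (3 * (m choose 2)) = exp (3 * (M * (M - 1) / 2) * Q)"
        unfolding q of_nat_mult of_nat_choose_two by (simp add: M_def)
      have 1: "(x * y / a) powi n * q powi (n * (n - 1)) = exp (N * (X + Y - A) + N * (N - 1) * Q)"
        unfolding xya q exp_power_int by (simp add: N_def exp_add)
      show ?thesis
        unfolding psi_term_def P xy C pow 1 w_def by (simp add: M_def exp_add mult_ac)
    qed
    finally show ?thesis .
  qed
  have summable: "(\<lambda>t. ?f (?g t)) summable_on UNIV \<times> UNIV"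
    using summable_on_reindex_bij_betw[OF bij, of ?f] prod(1) by simp
  have "P a * K x y a = infsum ?f UNIV"
    using prod(2) by (simp add: K_def euler mult.commute)
  also have "\<dots> = (\<Sum>\<^sub>\<infinity>t. ?f (?g t))"
    by (rule infsum_reindex_bij_betw[OF bij, symmetric])
  also have "\<dots> = (\<Sum>\<^sub>\<infinity>n. \<Sum>\<^sub>\<infinity>m. ?f (?g (n, m)))"
    using infsum_Sigma_banach[OF summable] by simp
  also have "\<dots> = (\<Sum>\<^sub>\<infinity>n. (x * y / a) powi n * q powi (n * (n - 1))
      * infsum (psi_term (x * q powi n) (y * q powi n)) UNIV)"
    unfolding shift infsum_cmult_right' ..
  also have "\<dots> = H x y a"
    using assms q_nz by (simp add: H_eq_Phi Phi_eq_psi)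
  finally show ?thesis ..
qed

section \<open>Bilateral series in terms of \<open>H\<close> and \<open>K\<close>\<close>

abbreviation qpowers :: "complex set" where "qpowers \<equiv> range (\<lambda>n::int. q powi n)"

lemma q_powi_mult_notin:
  assumes "z \<notin> qpowers"
  shows "q powi n * z \<notin> qpowers"
proof
  assume "q powi n * z \<in> qpowers"
  then obtain m where "q powi n * z = q powi m"
    by auto
  then have "z = q powi (m - n)"
    using q_nz by (simp add: power_int_diff field_simps)
  with assms show False by blast
qed

lemma q_divide_notin:
  assumes "z \<notin> qpowers"
  shows "q / z \<notin> qpowers"
proof
  assume "q / z \<in> qpowers"
  then obtain m where m: "q / z = q powi m"
    by auto
  then have "z \<noteq> 0"
    using q_nz by auto
  then have "z = q powi (1 - m)"
    using m q_nz by (simp add: power_int_diff field_simps)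
  with assms show False by blast
qed

text \<open>
  Removes the denominator of \<open>(z)\<^sub>n\<close>: this is \<open>theta_shift\<close> divided by \<open>P (z q^n)\<close>, used below at
  \<open>z = x / a\<close> and \<open>z = y / a\<close>.
\<close>

lemma P_mult_qpoch:
  assumes "z \<noteq> 0" "z \<notin> qpowers"
  shows "P (q / z) * qpoch q z n
    = (- z) powi n * q powi (n * (n - 1) div 2) * P (q powi (1 - n) / z)"
proof -
  have "P (q powi n * z) \<noteq> 0"
    using assms by (intro P_nz q_powi_mult_notin)
  moreover have "P (q / z) * P z = (- z) powi n * q powi (n * (n - 1) div 2)
      * P (q powi (1 - n) / z) * P (q powi n * z)"
    using theta_shift[OF assms(1), of n] by (simp add: mult_ac)
  ultimately show ?thesis
    by (simp add: qpoch_def field_simps)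
qed

lemma qpoch_0 [simp]: "qpoch q 0 n = 1"
  by (simp add: qpoch_def)

lemma q_triangle_square:
  "q powi (n * (n - 1) div 2) * q powi (n * (n - 1) div 2) = q powi (n * (n - 1))"
proof -
  have "n * (n - 1) div 2 + n * (n - 1) div 2 = n * (n - 1)"
    by (simp flip: mult_2)
  then show ?thesis
    using q_nz by (metis power_int_add)
qed

lemma neg_one_powi_square: "(-1) powi n * (-1) powi n = (1 :: complex)"
  by (simp flip: power_int_mult_distrib)

lemma neg_powi: "(- z) powi n = (-1) powi n * z powi n" for z :: complex
  using power_int_mult_distrib[of "-1" z n] by simp

lemma psi_1_2_term:
  assumes "x \<noteq> 0" "y \<noteq> 0" "a \<noteq> 0" "x \<notin> qpowers" "x / a \<notin> qpowers"
  shows "(P (a * q / x) * P x) * qpsi_term [x / a] [0, x] q y n = H_term x y a n"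
proof -
  have "P x \<noteq> 0"
    by (rule P_nz) fact
  have "(P (a * q / x) * P x) * qpsi_term [x / a] [0, x] q y n
      = (P (q / (x / a)) * qpoch q (x / a) n) * P (q powi n * x)
        * ((-1) powi n * q powi (n * (n - 1) div 2) * y powi n)"
    using \<open>P x \<noteq> 0\<close> by (simp add: qpsi_term_def qpochs_def qpoch_def[of q x] mult_ac)
  also have "\<dots> = ((-1) powi n * (-1) powi n) * ((x / a) powi n * y powi n)
      * (q powi (n * (n - 1) div 2) * q powi (n * (n - 1) div 2))
      * (P (x * q powi n) * P (a * q powi (1 - n) / x))"
    using assms by (subst P_mult_qpoch) (simp_all add: neg_powi[of "x / a"] mult_ac)
  also have "(x / a) powi n * y powi n = (x * y / a) powi n"
    by (simp flip: power_int_mult_distrib)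
  finally show ?thesis
    unfolding H_term_def neg_one_powi_square q_triangle_square by simp
qed

lemma psi_2_2_term:
  assumes "x \<noteq> 0" "y \<noteq> 0" "a \<noteq> 0" "x / a \<notin> qpowers" "y / a \<notin> qpowers"
  shows "(P (a * q / x) * P (a * q / y)) * qpsi_term [x / a, y / a] [0, 0] q a n
    = K_term (a * q / x) (a * q / y) a (- n)"
proof -
  have nz: "x / a \<noteq> 0" "y / a \<noteq> 0"
    using assms by auto
  have arg: "q powi (1 - n) / (z / a) = a * q / z * q powi (- n)" for z
    using q_nz by (simp add: power_int_diff power_int_minus field_simps)
  have "(P (a * q / x) * P (a * q / y)) * qpsi_term [x / a, y / a] [0, 0] q a n
      = (P (q / (x / a)) * qpoch q (x / a) n) * (P (q / (y / a)) * qpoch q (y / a) n) * a powi n"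
    by (simp add: qpsi_term_def qpochs_def mult_ac)
  also have "\<dots> = ((-1) powi n * (-1) powi n) * ((x / a) powi n * (y / a) powi n * a powi n)
      * (q powi (n * (n - 1) div 2) * q powi (n * (n - 1) div 2))
      * (P (q powi (1 - n) / (x / a)) * P (q powi (1 - n) / (y / a)))"
    unfolding P_mult_qpoch[OF nz(1) assms(4)]
      P_mult_qpoch[OF nz(2) assms(5)]
      neg_powi[of "x / a"] neg_powi[of "y / a"] by (simp only: mult_ac)
  also have "(x / a) powi n * (y / a) powi n * a powi n = (x * y / a) powi n"
    using assms(3) by (simp flip: power_int_mult_distrib)
  finally show ?thesis
    unfolding K_term_def reflect_weight[OF assms(1-3)] neg_one_powi_square q_triangle_square arg
    by simp
qed

lemma psi_0_2_term:
  assumes "x \<notin> qpowers" "y \<notin> qpowers"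
  shows "(P x * P y) * qpsi_term [] [x, y] q (x * y / a) n = K_term x y a n"
proof -
  have "P x \<noteq> 0" "P y \<noteq> 0"
    using assms by (simp_all add: P_nz)
  then have "(P x * P y) * qpsi_term [] [x, y] q (x * y / a) n
      = ((-1) powi n * (-1) powi n) * (q powi (n * (n - 1) div 2) * q powi (n * (n - 1) div 2))
        * (x * y / a) powi n * (P (q powi n * x) * P (q powi n * y))"
    by (simp add: qpsi_term_def qpochs_def qpoch_def power2_eq_square)
  then show ?thesis
    unfolding K_term_def neg_one_powi_square q_triangle_square by (simp add: mult_ac)
qed

lemma
  assumes "x \<noteq> 0" "y \<noteq> 0" "a \<noteq> 0" "x \<notin> qpowers" "x / a \<notin> qpowers"
  shows psi_1_2_converges: "qpsi_converges [x / a] [0, x] q y"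
    and psi_1_2: "(P (a * q / x) * P x) * qpsi [x / a] [0, x] q y = H x y a"
proof -
  have "q / (x / a) \<notin> qpowers"
    using assms by (intro q_divide_notin)
  then have "P (a * q / x) * P x \<noteq> 0"
    using P_nz[of x] P_nz[of "a * q / x"] assms by (simp add: mult.commute)
  note * = summable_infsum_of_cmult_eq[OF psi_1_2_term[OF assms] this H_summable[OF assms(1-3)]]
  show "qpsi_converges [x / a] [0, x] q y"
    using *(1) by (simp add: qpsi_converges_def)
  show "(P (a * q / x) * P x) * qpsi [x / a] [0, x] q y = H x y a"
    using *(2) by (simp add: qpsi_def H_def)
qed

lemma
  assumes "x \<noteq> 0" "y \<noteq> 0" "a \<noteq> 0" "norm a < 1" "x / a \<notin> qpowers" "y / a \<notin> qpowers"
  shows psi_2_2_converges: "qpsi_converges [x / a, y / a] [0, 0] q a"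
    and psi_2_2: "P a * (P (a * q / x) * P (a * q / y)) * qpsi [x / a, y / a] [0, 0] q a = H x y a"
proof -
  let ?x = "a * q / x" and ?y = "a * q / y"
  have nz: "?x \<noteq> 0" "?y \<noteq> 0"
    using assms q_nz by auto
  have bij: "bij_betw uminus UNIV (UNIV :: int set)"
    by (simp add: bij_uminus)
  have sum: "(\<lambda>n. K_term ?x ?y a (- n)) summable_on UNIV"
    using summable_on_reindex_bij_betw[OF bij, of "K_term ?x ?y a"] K_summable[OF nz assms(3,4)] by simp
  have "q / (x / a) \<notin> qpowers" "q / (y / a) \<notin> qpowers"
    using assms(5,6) by (simp_all only: q_divide_notin not_False_eq_True)
  then have "P ?x * P ?y \<noteq> 0"
    using P_nz[of ?x] P_nz[of ?y] by (simp add: mult.commute)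
  note * = summable_infsum_of_cmult_eq[OF psi_2_2_term[OF assms(1-3,5,6)] this sum]
  show "qpsi_converges [x / a, y / a] [0, 0] q a"
    using *(1) by (simp add: qpsi_converges_def)
  have "(P ?x * P ?y) * qpsi [x / a, y / a] [0, 0] q a = K ?x ?y a"
    using *(2) infsum_reindex_bij_betw[OF bij, of "K_term ?x ?y a"] by (simp add: qpsi_def K_def)
  then have "P a * (P ?x * P ?y) * qpsi [x / a, y / a] [0, 0] q a = P a * K ?x ?y a"
    by (simp only: mult.assoc)
  also have "\<dots> = H x y a"
    using H_eq_K[OF nz assms(3,4)] H_reflect[OF assms(1-3)] by simp
  finally show "P a * (P ?x * P ?y) * qpsi [x / a, y / a] [0, 0] q a = H x y a" .
qed

lemma
  assumes "x \<noteq> 0" "y \<noteq> 0" "a \<noteq> 0" "norm a < 1" "x \<notin> qpowers" "y \<notin> qpowers"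
  shows psi_0_2_converges: "qpsi_converges [] [x, y] q (x * y / a)"
    and psi_0_2: "P a * (P x * P y) * qpsi [] [x, y] q (x * y / a) = H x y a"
proof -
  have "P x * P y \<noteq> 0"
    using assms by (simp add: P_nz)
  note * = summable_infsum_of_cmult_eq[OF psi_0_2_term[OF assms(5,6)] this K_summable[OF assms(1-4)]]
  show "qpsi_converges [] [x, y] q (x * y / a)"
    using *(1) by (simp add: qpsi_converges_def)
  have "(P x * P y) * qpsi [] [x, y] q (x * y / a) = K x y a"
    using *(2) by (simp add: qpsi_def K_def)
  then show "P a * (P x * P y) * qpsi [] [x, y] q (x * y / a) = H x y a"
    by (simp only: mult.assoc H_eq_K[OF assms(1-4)])
qed

lemma qtheta_neg: "qtheta q (- z) = P q * P z * P (q / z)"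
  by (simp add: qtheta_def qpochs_inf_def)

end

section \<open>The transformation formulas for \<open>\<mu>\<close>\<close>

theorem theorem1p4:
  fixes \<tau> \<alpha> u v q x y a :: complex
  assumes "Im \<tau> > 0"
    and "q = cis2pi \<tau>" and "x = cis2pi u" and "y = cis2pi v" and "a = qpow \<tau> \<alpha>"
    and "x \<notin> range (\<lambda>n::int. q powi n)"
    and "y \<notin> range (\<lambda>n::int. q powi n)"
    and "x / a \<notin> range (\<lambda>n::int. q powi n)"
    and "y / a \<notin> range (\<lambda>n::int. q powi n)"
  shows "qpsi_converges [x / a] [0, x] q y \<and> qpsi_converges [y / a] [0, y] q x \<and>
    gmu \<tau> u v \<alpha> =
      - \<i> * qpow \<tau> (- 1 / 8) * (ratio_pow \<alpha> u v / qtheta q (- x / a))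
      * (qpoch_inf q (a * q / y) / qpoch_inf q (q / y))
      * qpsi [y / a] [0, y] q x \<and>
    (norm a < 1 \<longrightarrow>
      qpsi_converges [x / a, y / a] [0, 0] q a \<and>
      qpsi_converges [] [x, y] q (x * y / a) \<and>
      gmu \<tau> u v \<alpha> =
        - \<i> * qpow \<tau> (- 1 / 8) * ratio_pow \<alpha> u v
        * (qpochs_inf q [a, q, a * q / x, a * q / y] / (qtheta q (- y) * qtheta q (- x / a)))
        * qpsi [x / a, y / a] [0, 0] q a \<and>
      gmu \<tau> u v \<alpha> =
        - \<i> * qpow \<tau> (- 1 / 8) * ratio_pow \<alpha> u v
        * (qpochs_inf q [a, q, x, y] / (qtheta q (- y) * qtheta q (- x / a)))
        * qpsi [] [x, y] q (x * y / a))"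
proof -
  have nome: "nome q"
  proof
    show "q \<noteq> 0"
      by (simp add: assms(2) cis2pi_def)
    show "norm q < 1"
      using assms(1) by (simp add: assms(2) cis2pi_def)
  qed
  note notin = assms(6-9)
  have nz: "x \<noteq> 0" "y \<noteq> 0" "a \<noteq> 0"
    by (simp_all add: assms(3-5) cis2pi_def qpow_def)
  define C where "C = - \<i> * qpow \<tau> (- 1 / 8) * ratio_pow \<alpha> u v"
  \<comment> \<open>each expression for \<open>\<mu>\<close> is brought to the form \<open>D * ?P q * H\<close>\<close>
  define D where "D = C / (qtheta q (- y) * qtheta q (- x / a))"
  let ?P = "qpoch_inf q"
  have P_nz: "?P z \<noteq> 0" "?P (q / z) \<noteq> 0" if "z \<notin> range (\<lambda>n::int. q powi n)" for z
    using that nome.P_nz[OF nome] nome.q_divide_notin[OF nome] by blast+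
  have theta_y: "qtheta q (- y) = ?P q * ?P y * ?P (q / y)"
    by (rule nome.qtheta_neg[OF nome])
  have theta_x: "qtheta q (- x / a) = ?P q * ?P (x / a) * ?P (a * q / x)"
    using nome.qtheta_neg[OF nome, of "x / a"] by (simp add: mult.commute)
  have nz': "?P q \<noteq> 0" "?P x \<noteq> 0" "?P y \<noteq> 0" "?P (q / y) \<noteq> 0" "?P (x / a) \<noteq> 0"
      "?P (a * q / x) \<noteq> 0" "?P (a * q / y) \<noteq> 0"
    using nome.Pq_nz[OF nome] P_nz[OF notin(1)] P_nz[OF notin(2)] P_nz[OF notin(3)] P_nz[OF notin(4)]
    by (simp_all add: mult.commute)
  define H where "H = nome.H q x y a"
  have psi_x: "(?P (a * q / x) * ?P x) * qpsi [x / a] [0, x] q y = H"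
    using nome.psi_1_2[OF nome nz notin(1,3)] by (simp add: H_def)
  have psi_y: "(?P (a * q / y) * ?P y) * qpsi [y / a] [0, y] q x = H"
    using nome.psi_1_2[OF nome nz(2,1,3) notin(2,4)] nome.H_commute[OF nome nz] by (simp add: H_def)
  have gmu: "gmu \<tau> u v \<alpha> = D * ?P q * H"
  proof -
    have "gmu \<tau> u v \<alpha> = C / qtheta q (- y) * (?P x / ?P (x / a)) * qpsi [x / a] [0, x] q y"
      by (simp add: gmu_def Let_def C_def assms(2-5))
    also have "\<dots> = D * ?P q * H"
      unfolding psi_x[symmetric] D_def theta_x using nz' by (simp add: field_simps)
    finally show ?thesis .
  qed
  have first: "gmu \<tau> u v \<alpha> = - \<i> * qpow \<tau> (- 1 / 8) * (ratio_pow \<alpha> u v / qtheta q (- x / a))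
      * (?P (a * q / y) / ?P (q / y)) * qpsi [y / a] [0, y] q x"
  proof -
    have "D * ?P q * H = C / qtheta q (- x / a) * (?P (a * q / y) / ?P (q / y)) * qpsi [y / a] [0, y] q x"
      unfolding psi_y[symmetric] D_def theta_y using nz' by (simp add: field_simps)
    then show ?thesis
      by (simp add: gmu C_def)
  qed
  have D: "D * w * z = - \<i> * qpow \<tau> (- 1 / 8) * ratio_pow \<alpha> u v
      * (w / (qtheta q (- y) * qtheta q (- x / a))) * z" for w z
    by (simp add: D_def C_def)
  have "qpsi_converges [x / a, y / a] [0, 0] q a \<and>
      qpsi_converges [] [x, y] q (x * y / a) \<and>
      gmu \<tau> u v \<alpha> = D * qpochs_inf q [a, q, a * q / x, a * q / y] * qpsi [x / a, y / a] [0, 0] q a \<and>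
      gmu \<tau> u v \<alpha> = D * qpochs_inf q [a, q, x, y] * qpsi [] [x, y] q (x * y / a)" if "norm a < 1"
  proof (intro conjI)
    show "qpsi_converges [x / a, y / a] [0, 0] q a"
      by (rule nome.psi_2_2_converges[OF nome nz that notin(3,4)])
    show "qpsi_converges [] [x, y] q (x * y / a)"
      by (rule nome.psi_0_2_converges[OF nome nz that notin(1,2)])
    show "gmu \<tau> u v \<alpha> = D * qpochs_inf q [a, q, a * q / x, a * q / y] * qpsi [x / a, y / a] [0, 0] q a"
      unfolding gmu H_def nome.psi_2_2[OF nome nz that notin(3,4), symmetric]
      by (simp add: qpochs_inf_def)
    show "gmu \<tau> u v \<alpha> = D * qpochs_inf q [a, q, x, y] * qpsi [] [x, y] q (x * y / a)"
      unfolding gmu H_def nome.psi_0_2[OF nome nz that notin(1,2), symmetric]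
      by (simp add: qpochs_inf_def)
  qed
  then show ?thesis
    unfolding D
    using nome.psi_1_2_converges[OF nome nz notin(1,3)]
      nome.psi_1_2_converges[OF nome nz(2,1,3) notin(2,4)] first
    by blast
qed

end
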